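(* Let $\varkappa\le 0$ be a real number and let $n\ge 2$ be an integer. Let $p$ be a real polynomial of degree $n$ all of whose real zeros are simple, and such that all zeros of the derivative $p'$ are real and simple. Then $$Z_{\mathbb R}\left(H_{\varkappa}[p]\right)=n+Z_{\mathbb R}(p)-2.$$
   Context: For a real polynomial $p$ and a real number $\varkappa$, $H_{\varkappa}[p](x)=\varkappa\,(p'(x))^2-p(x)p''(x)$. For a real polynomial $f$, $Z_{\mathbb R}(f)$ denotes the number of real zeros of $f$ counted with multiplicity. *)

theory Defs
  imports "HOL-Analysis.Analysis" "HOL-Computational_Algebra.Computational_Algebra"
begin

definition H_poly :: "real \<Rightarrow> real poly \<Rightarrow> real poly" where
  "H_poly \<kappa> p = smult \<kappa> ((pderiv p)\<^sup>2) - p * pderiv (pderiv p)"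

text \<open>Since \<^term>\<open>sum\<close> over an infinite set is \<open>0\<close>, this takes the junk value \<open>0\<close> at the zero polynomial.\<close>

definition Z_real :: "real poly \<Rightarrow> nat" where
  "Z_real f = (\<Sum>x | poly f x = 0. order x f)"

end

theory Submission
  imports Defs
begin

text \<open>
  Put \<open>a = - \<kappa>\<close>, \<open>q = p * p'\<close> and \<open>H = H_poly \<kappa> p\<close>. Since \<open>p'\<close> has only real zeros, it satisfies
  Laguerre's inequality \<open>p' p''' \<le> p''\<^sup>2\<close>. Substituting \<open>p p'' = - a p'\<^sup>2\<close> into \<open>q H'\<close> then shows
  that, for \<open>a > 0\<close>, \<open>q H' > 0\<close> at every zero of \<open>H\<close>, and clearly \<open>q' H < 0\<close> at every zero of \<open>q\<close>.
  So all zeros of \<open>q\<close> and \<open>H\<close> are simple and they interlace; the signs at infinity show that the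
  outermost zeros belong to \<open>q\<close>. Hence \<open>H\<close> has one zero less than \<open>q\<close>, which has
  \<open>Z_real p + (n - 1)\<close> zeros.
  For \<open>\<kappa> = 0\<close> the claim is that \<open>p''\<close> has \<open>n - 2\<close> real zeros, which is Rolle's theorem.
\<close>

section \<open>Real-rooted polynomials\<close>

lemma poly_map_complex_of_real:
  "poly (map_poly complex_of_real f) (of_real x) = of_real (poly f x)"
  by (induction f) (auto simp: map_poly_pCons)

lemma pderiv_map_complex_of_real:
  "pderiv (map_poly complex_of_real f) = map_poly of_real (pderiv f)"
  by (rule poly_eqI) (simp add: coeff_pderiv coeff_map_poly)

lemma map_complex_of_real_mult:
  "map_poly complex_of_real (f * g) = map_poly of_real f * map_poly of_real g"
  by (rule poly_eqI) (simp add: coeff_mult coeff_map_poly)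

text \<open>The fundamental theorem of algebra supplies a zero, which is real by assumption, so a
  real linear factor splits off. The quotient is again real-rooted and has smaller degree.\<close>

lemma real_rooted_induct [consumes 2, case_names const factor]:
  fixes f :: "real poly"
  assumes "\<forall>z. poly (map_poly complex_of_real f) z = 0 \<longrightarrow> z \<in> \<real>"
    and "f \<noteq> 0"
    and "\<And>c. c \<noteq> 0 \<Longrightarrow> P [:c:]"
    and "\<And>c g. g \<noteq> 0 \<Longrightarrow> P g \<Longrightarrow> P ([:-c, 1:] * g)"
  shows "P f"
  using assms(1,2)
proof (induction "degree f" arbitrary: f)
  case 0
  then obtain c where "f = [:c:]"
    by (metis degree_eq_zeroE)
  then show ?case using 0 assms(3) by auto
next
  case (Suc d)
  have "\<not> constant (poly (map_poly complex_of_real f))"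
    using Suc.hyps(2) by (simp add: constant_degree degree_map_poly)
  then obtain z where z: "poly (map_poly complex_of_real f) z = 0"
    using fundamental_theorem_of_algebra by blast
  with Suc.prems obtain c where c: "z = of_real c"
    by (metis Reals_cases)
  with z have "poly f c = 0"
    by (simp add: poly_map_complex_of_real)
  then obtain g where g: "f = [:-c, 1:] * g"
    by (metis poly_eq_0_iff_dvd dvdE)
  have "g \<noteq> 0" using g Suc.prems by auto
  then have "d = degree g"
    using Suc.hyps(2) g by (simp add: degree_mult_eq del: mult_pCons_left)
  moreover have "z \<in> \<real>" if "poly (map_poly complex_of_real g) z = 0" for z
    using that Suc.prems(1)[rule_format, of z] unfolding g map_complex_of_real_mult by simp
  ultimately have "P g"
    using Suc.hyps(1) \<open>g \<noteq> 0\<close> by blast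
  then show ?case using g \<open>g \<noteq> 0\<close> assms(4) by blast
qed

lemma real_rooted_size_proots:
  assumes "\<forall>z. poly (map_poly complex_of_real f) z = 0 \<longrightarrow> z \<in> \<real>" "f \<noteq> 0"
  shows "size (proots f) = degree f"
  using assms
proof (induction rule: real_rooted_induct)
  case (factor c g)
  then show ?case
    by (simp add: proots_mult degree_mult_eq proots_linear_factor[of "-c", simplified]
        del: mult_pCons_left)
qed simp

text \<open>Away from the zeros of \<open>f\<close> this says that \<open>f' / f\<close>, a sum of
  terms \<open>1 / (x - c)\<close>, has nonpositive derivative. Induction over the linear factors
  avoids the division and covers the zeros as well.\<close>

lemma laguerre_inequality:
  assumes "\<forall>z. poly (map_poly complex_of_real f) z = 0 \<longrightarrow> z \<in> \<real>" "f \<noteq> 0"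
  shows "poly f x * poly (pderiv (pderiv f)) x \<le> (poly (pderiv f) x)\<^sup>2"
  using assms
proof (induction rule: real_rooted_induct)
  case (factor c g)
  have pderiv_factor: "pderiv ([:-c, 1:] * h) = h + [:-c, 1:] * pderiv h" for h
    unfolding pderiv_mult by (simp add: pderiv_pCons)
  define u v w where "u = poly g x" and "v = poly (pderiv g) x" and "w = poly (pderiv (pderiv g)) x"
  \<comment> \<open>The left side is \<open>f'^2 - f * f''\<close> for
    \<open>f = (x - c) * g\<close>; the mixed terms cancel.\<close>
  have "(u + (x - c) * v)\<^sup>2 - (x - c) * u * (2 * v + (x - c) * w) = u\<^sup>2 + (x - c)\<^sup>2 * (v\<^sup>2 - u * w)"
    by (simp add: power2_eq_square algebra_simps)
  moreover have "u * w \<le> v\<^sup>2"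
    using factor by (simp add: u_def v_def w_def)
  ultimately have "(x - c) * u * (2 * v + (x - c) * w) \<le> (u + (x - c) * v)\<^sup>2"
    by (smt (verit) mult_nonneg_nonneg zero_le_power2)
  moreover have "poly (pderiv ([:-c, 1:] * g)) x = u + (x - c) * v"
    unfolding pderiv_factor by (simp add: u_def v_def algebra_simps)
  moreover have "poly (pderiv (pderiv ([:-c, 1:] * g))) x = 2 * v + (x - c) * w"
    unfolding pderiv_factor pderiv_add by (simp add: v_def w_def algebra_simps)
  moreover have "poly ([:-c, 1:] * g) x = (x - c) * u"
    by (simp add: u_def algebra_simps)
  ultimately show ?case by metis
qed (simp add: pderiv_pCons)

section \<open>Counting real zeros with and without multiplicity\<close>

lemma Z_real_eq_size_proots: "f \<noteq> 0 \<Longrightarrow> Z_real f = size (proots f)"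
  by (simp add: Z_real_def size_multiset_overloaded_eq)

lemma Z_real_mult: "f \<noteq> 0 \<Longrightarrow> g \<noteq> 0 \<Longrightarrow> Z_real (f * g) = Z_real f + Z_real g"
  by (simp add: Z_real_eq_size_proots proots_mult)

lemma Z_real_uminus: "Z_real (- f) = Z_real f"
  by (simp add: Z_real_def)

lemma Z_real_simple:
  assumes "\<And>x. poly f x = 0 \<Longrightarrow> order x f = 1"
  shows "Z_real f = card {x. poly f x = 0}"
  using assms by (simp add: Z_real_def)

lemma card_roots_le_Z_real:
  assumes "f \<noteq> 0"
  shows "card {x. poly f x = 0} \<le> Z_real f"
proof -
  have "(\<Sum>x | poly f x = 0. 1) \<le> (\<Sum>x | poly f x = 0. order x f)"
    using assms by (intro sum_mono) (metis One_nat_def Suc_leI mem_Collect_eq order_gt_0_iff)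
  then show ?thesis by (simp add: Z_real_def)
qed

lemma order_eq_1_iff:
  fixes f :: "real poly"
  assumes "f \<noteq> 0" "poly f x = 0"
  shows "order x f = 1 \<longleftrightarrow> poly (pderiv f) x \<noteq> 0"
proof -
  have "pderiv f \<noteq> 0"
    using assms by (metis degree_eq_zeroE pderiv_eq_0_iff poly_const_conv pCons_eq_0_iff)
  then show ?thesis
    using order_pderiv[OF assms] by (simp add: order_eq_0_iff)
qed

section \<open>Interlacing zeros\<close>

text \<open>Sending each element of \<open>A\<close> except the largest to the least element of
  \<open>B\<close> above it is injective, since the image stays below every larger element of
  \<open>A\<close>.\<close>

lemma card_le_Suc_card_between:
  fixes A B :: "'a :: linorder set"
  assumes "finite A" "finite B"
    and between: "\<And>x y. x \<in> A \<Longrightarrow> y \<in> A \<Longrightarrow> x < y \<Longrightarrow> A \<inter> {x<..<y} = {} \<Longrightarrow> \<exists>b\<in>B. x < b \<and> b < y"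
  shows "card A \<le> card B + 1"
proof (cases "A = {}")
  case False
  have ex: "\<exists>b\<in>B. x < b \<and> b < y" if xy: "x \<in> A" "y \<in> A" "x < y" for x y
  proof -
    \<comment> \<open>The successor of \<open>x\<close> in \<open>A\<close>: the hypothesis speaks
      of neighbours only, and this extends it to all pairs.\<close>
    define y' where "y' = Min {a \<in> A. x < a}"
    have ne: "{a \<in> A. x < a} \<noteq> {}" "finite {a \<in> A. x < a}" using that assms by auto
    then have "y' \<in> {a \<in> A. x < a}" unfolding y'_def by (rule Min_in[rotated])
    moreover have le: "y' \<le> a" if "a \<in> A" "x < a" for a
      unfolding y'_def using ne that by simp
    moreover have "A \<inter> {x<..<y'} = {}" using le by force
    ultimately obtain b where "b \<in> B" "x < b" "b < y'"
      using between[of x y'] xy(1) by blast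
    then show ?thesis using le[of y] xy by (meson order.strict_trans2)
  qed
  define s where "s x = Min {b \<in> B. x < b}" for x
  have s: "s x \<in> B" "x < s x" "s x < y" if xy: "x \<in> A" "y \<in> A" "x < y" for x y
  proof -
    obtain b where b: "b \<in> B" "x < b" "b < y" using ex[OF xy] by blast
    then have fin: "finite {b \<in> B. x < b}" "{b \<in> B. x < b} \<noteq> {}" using assms by auto
    from Min_in[OF this] show "s x \<in> B" "x < s x" by (auto simp: s_def)
    have "s x \<le> b" using fin b by (simp add: s_def)
    with b show "s x < y" by order
  qed
  have m: "x < Max A" if "x \<in> A - {Max A}" for x
    using that assms by (simp add: order.not_eq_order_implies_strict)
  have M: "Max A \<in> A" using False assms by simp
  have "inj_on s (A - {Max A})"
  proof (rule linorder_inj_onI')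
    fix x y assume xy: "x \<in> A - {Max A}" "y \<in> A - {Max A}" "x < y"
    then show "s x \<noteq> s y"
      using s(3)[of x y] s(2)[of y "Max A"] m[of y] M by auto
  qed
  moreover have "s ` (A - {Max A}) \<subseteq> B"
    using s(1) m M by blast
  ultimately have "card (A - {Max A}) \<le> card B"
    using assms by (meson card_inj_on_le)
  then show ?thesis using M assms by simp
qed simp

text \<open>Immediately to the right of a simple zero \<open>f\<close> has the sign of its
  derivative there, and by the intermediate value theorem it keeps that sign up to
  \<open>m\<close>.\<close>

lemma poly_sign_right:
  fixes f :: "real poly"
  assumes "x < m" "\<And>t. x < t \<Longrightarrow> t \<le> m \<Longrightarrow> poly f t \<noteq> 0"
    and "poly f x = 0" "poly (pderiv f) x \<noteq> 0"
  shows "poly (pderiv f) x * poly f m > 0"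
proof -
  have *: "poly f m > 0" if f: "x < m" "\<And>t. x < t \<Longrightarrow> t \<le> m \<Longrightarrow> poly f t \<noteq> 0"
    "poly f x = 0" "poly (pderiv f) x > 0" for f
  proof -
    obtain d where d: "d > 0" "\<And>h. h > 0 \<Longrightarrow> h < d \<Longrightarrow> poly f x < poly f (x + h)"
      using DERIV_pos_inc_right[OF poly_DERIV f(4)] by blast
    define h where "h = min (d / 2) ((m - x) / 2)"
    have h: "h > 0" "h < d" "x + h < m"
      using d(1) \<open>x < m\<close> by (auto simp: h_def min_def field_simps)
    then have "poly f (x + h) > 0" using d f(3) by fastforce
    with h show ?thesis
      using poly_IVT_neg[of "x + h" m f] f(2)[of m] f(2)
      by (smt (verit))
  qed
  show ?thesis
  proof (cases "poly (pderiv f) x > 0")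
    case True
    then show ?thesis using *[of f] assms by simp
  next
    case False
    then show ?thesis using *[of "- f"] assms by (simp add: pderiv_minus mult_neg_neg)
  qed
qed

text \<open>Reflection in the origin reduces this to \<open>poly_sign_right\<close>; the derivative
  changes sign, which reverses the inequality.\<close>

lemma poly_sign_left:
  fixes f :: "real poly"
  assumes "m < x" "\<And>t. m \<le> t \<Longrightarrow> t < x \<Longrightarrow> poly f t \<noteq> 0"
    and "poly f x = 0" "poly (pderiv f) x \<noteq> 0"
  shows "poly (pderiv f) x * poly f m < 0"
proof -
  define g where "g = pcompose f [:0, -1:]"
  have g: "poly g t = poly f (- t)" "poly (pderiv g) t = - poly (pderiv f) (- t)" for t
    by (simp_all add: g_def poly_pcompose pderiv_pcompose pderiv_pCons)
  have "poly (pderiv g) (- x) * poly g (- m) > 0"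
    by (rule poly_sign_right) (use assms in \<open>auto simp: g\<close>)
  then show ?thesis by (simp add: g)
qed

text \<open>At the midpoint \<open>m\<close>, \<open>f\<close> has the sign of \<open>g x\<close>
  and the sign opposite to \<open>g y\<close>, so \<open>g\<close> changes sign. The second
  alternatives admit end points that are not zeros of \<open>f\<close>, as required for the gaps
  next to the outermost zeros.\<close>

lemma poly_root_between_simple_roots:
  fixes f g :: "real poly"
  assumes "x < y" "\<And>t. x < t \<Longrightarrow> t < y \<Longrightarrow> poly f t \<noteq> 0"
    and x: "poly f x = 0 \<and> poly g x * poly (pderiv f) x > 0 \<or> poly g x * poly f x > 0"
    and y: "poly f y = 0 \<and> poly g y * poly (pderiv f) y > 0 \<or> poly g y * poly f y < 0"
  shows "\<exists>t>x. t < y \<and> poly g t = 0"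
proof -
  define m where "m = (x + y) / 2"
  have m: "x < m" "m < y" using assms by (auto simp: m_def)
  have "poly g x * poly f m > 0"
  proof (cases "poly f x = 0")
    case True
    then have "poly (pderiv f) x * poly f m > 0" "poly g x * poly (pderiv f) x > 0"
      using assms m x by (auto intro!: poly_sign_right)
    then show ?thesis by (simp add: zero_less_mult_iff) linarith
  next
    case False
    have "poly f x * poly f m \<ge> 0"
      using poly_IVT[of x m f] m assms(2) by force
    moreover have "poly f m \<noteq> 0" using m assms(2) by blast
    ultimately show ?thesis
      using x False by (auto simp: zero_less_mult_iff zero_le_mult_iff)
  qed
  moreover have "poly g y * poly f m < 0"
  proof (cases "poly f y = 0")
    case True
    then have "poly (pderiv f) y * poly f m < 0" "poly g y * poly (pderiv f) y > 0"
      using assms m y by (auto intro!: poly_sign_left)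
    then show ?thesis by (simp add: zero_less_mult_iff mult_less_0_iff) linarith
  next
    case False
    have "poly f m * poly f y \<ge> 0"
      using poly_IVT[of m y f] m assms(2) by force
    moreover have "poly f m \<noteq> 0" using m assms(2) by blast
    ultimately show ?thesis
      using y False by (auto simp: mult_less_0_iff zero_le_mult_iff)
  qed
  ultimately have "poly g x * poly g y < 0"
    by (auto simp: zero_less_mult_iff mult_less_0_iff)
  then show ?thesis using poly_IVT \<open>x < y\<close> by blast
qed

text \<open>In degree at least 2 the leading coefficients of \<open>p\<close>, \<open>p'\<close> and
  \<open>p''\<close> share one sign, so both products have positive leading coefficient.\<close>

lemma eventually_poly_times_pderivs_pos:
  fixes p :: "real poly"
  assumes "degree p \<ge> 2"
  shows "\<exists>M. \<forall>x\<ge>M. poly p x * poly (pderiv p) x > 0 \<and> poly p x * poly (pderiv (pderiv p)) x > 0"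
proof -
  have lc: "lead_coeff p \<noteq> 0" using assms by auto
  have d1: "lead_coeff (pderiv p) = real (degree p) * lead_coeff p"
    using assms by (simp add: coeff_pderiv degree_pderiv)
  have d2: "lead_coeff (pderiv (pderiv p)) = real (degree p - 1) * (real (degree p) * lead_coeff p)"
    using assms by (simp add: coeff_pderiv degree_pderiv Suc_diff_Suc numeral_2_eq_2)
  have lc2: "lead_coeff p * lead_coeff p > 0" using lc by (metis not_real_square_gt_zero)
  have "lead_coeff (p * pderiv p) = real (degree p) * (lead_coeff p * lead_coeff p)"
    unfolding lead_coeff_mult d1 by simp
  also have "\<dots> > 0" using assms by (intro mult_pos_pos[OF _ lc2]) simp
  finally have pos1: "lead_coeff (p * pderiv p) > 0" .
  have "lead_coeff (p * pderiv (pderiv p))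
      = (real (degree p - 1) * real (degree p)) * (lead_coeff p * lead_coeff p)"
    unfolding lead_coeff_mult d2 by simp
  also have "\<dots> > 0" using lc2 assms by (intro mult_pos_pos[OF _ lc2]) auto
  finally have pos2: "lead_coeff (p * pderiv (pderiv p)) > 0" .
  obtain M N where "\<forall>x\<ge>M. poly (p * pderiv p) x \<ge> lead_coeff (p * pderiv p)"
    "\<forall>x\<ge>N. poly (p * pderiv (pderiv p)) x \<ge> lead_coeff (p * pderiv (pderiv p))"
    using poly_pinfty_gt_lc[OF pos1] poly_pinfty_gt_lc[OF pos2] by blast
  then have "\<forall>x\<ge>max M N. poly p x * poly (pderiv p) x > 0 \<and> poly p x * poly (pderiv (pderiv p)) x > 0"
    using pos1 pos2 by (auto simp del: lead_coeff_mult intro: order.strict_trans2)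
  then show ?thesis by blast
qed

lemma poly_times_pderivs_signs_at_infinity:
  fixes p :: "real poly"
  assumes "degree p \<ge> 2"
  obtains M where
    "\<And>x. x \<ge> M \<Longrightarrow> poly p x * poly (pderiv p) x > 0 \<and> poly p x * poly (pderiv (pderiv p)) x > 0"
    "\<And>x. x \<le> - M \<Longrightarrow> poly p x * poly (pderiv p) x < 0 \<and> poly p x * poly (pderiv (pderiv p)) x > 0"
proof -
  obtain M where M: "\<And>x. x \<ge> M \<Longrightarrow> poly p x * poly (pderiv p) x > 0 \<and> poly p x * poly (pderiv (pderiv p)) x > 0"
    using eventually_poly_times_pderivs_pos[OF assms] by blast
  \<comment> \<open>Under reflection \<open>p'\<close> changes sign and \<open>p''\<close> does not,
    hence the sign change of \<open>p * p'\<close> alone at minus infinity.\<close>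
  define g where "g = pcompose p [:0, -1:]"
  have g: "poly g t = poly p (- t)" "poly (pderiv g) t = - poly (pderiv p) (- t)"
    "poly (pderiv (pderiv g)) t = poly (pderiv (pderiv p)) (- t)" for t
    by (simp_all add: g_def poly_pcompose pderiv_pcompose pderiv_pCons pderiv_mult pderiv_minus)
  have "degree g \<ge> 2" using assms by (simp add: g_def degree_pcompose)
  then obtain N where N: "\<And>x. x \<ge> N \<Longrightarrow> poly g x * poly (pderiv g) x > 0 \<and> poly g x * poly (pderiv (pderiv g)) x > 0"
    using eventually_poly_times_pderivs_pos by blast
  show ?thesis
  proof (rule that[of "max M N"])
    fix x assume "x \<le> - max M N"
    then show "poly p x * poly (pderiv p) x < 0 \<and> poly p x * poly (pderiv (pderiv p)) x > 0"
      using N[of "- x"] by (simp add: g)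
  qed (use M in auto)
qed

section \<open>The zeros of \<open>H_poly\<close>\<close>

lemma poly_H_poly:
  "poly (H_poly \<kappa> p) x = \<kappa> * (poly (pderiv p) x)\<^sup>2 - poly p x * poly (pderiv (pderiv p)) x"
  by (simp add: H_poly_def)

lemma poly_pderiv_H_poly:
  "poly (pderiv (H_poly \<kappa> p)) x
    = (2 * \<kappa> - 1) * poly (pderiv p) x * poly (pderiv (pderiv p)) x
      - poly p x * poly (pderiv (pderiv (pderiv p))) x"
  by (simp add: H_poly_def pderiv_diff pderiv_smult pderiv_mult power2_eq_square algebra_simps)

lemma pderiv_H_poly_sign:
  assumes "\<kappa> < 0" "poly (H_poly \<kappa> p) x = 0" "poly p x \<noteq> 0" "poly (pderiv p) x \<noteq> 0"
    and laguerre: "poly (pderiv p) x * poly (pderiv (pderiv (pderiv p))) x \<le> (poly (pderiv (pderiv p)) x)\<^sup>2"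
  shows "poly (p * pderiv p) x * poly (pderiv (H_poly \<kappa> p)) x > 0"
proof -
  define u v w z where "u = poly p x" and "v = poly (pderiv p) x"
    and "w = poly (pderiv (pderiv p)) x" and "z = poly (pderiv (pderiv (pderiv p))) x"
  have uw: "u * w = \<kappa> * v\<^sup>2"
    using assms(2) by (simp add: poly_H_poly u_def v_def w_def)
  \<comment> \<open>Scaling Laguerre's inequality by \<open>u\<^sup>2\<close> turns its right side
    into \<open>(u * w)\<^sup>2\<close>, which is known at a zero of \<open>H\<close>.\<close>
  have "u\<^sup>2 * (v * z) \<le> u\<^sup>2 * w\<^sup>2"
    using laguerre by (intro mult_left_mono) (auto simp: v_def w_def z_def)
  also have "\<dots> = (\<kappa> * v\<^sup>2)\<^sup>2"
    unfolding uw[symmetric] by (simp add: power_mult_distrib)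
  finally have le: "u\<^sup>2 * (v * z) \<le> (\<kappa> * v\<^sup>2)\<^sup>2" .
  have "0 < (\<kappa> * (\<kappa> - 1)) * (v\<^sup>2)\<^sup>2"
    using assms by (intro mult_pos_pos mult_neg_neg) (auto simp: v_def)
  also have "\<dots> = (2 * \<kappa> - 1) * v\<^sup>2 * (\<kappa> * v\<^sup>2) - (\<kappa> * v\<^sup>2)\<^sup>2"
    by (simp add: power2_eq_square algebra_simps)
  also have "\<dots> \<le> (2 * \<kappa> - 1) * v\<^sup>2 * (u * w) - u\<^sup>2 * (v * z)"
    using le by (simp add: uw)
  also have "\<dots> = (u * v) * ((2 * \<kappa> - 1) * v * w - u * z)"
    by (simp add: power2_eq_square algebra_simps)
  finally show ?thesis
    by (simp add: poly_pderiv_H_poly u_def v_def w_def z_def)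
qed

text \<open>Interlacing is counted in both directions: a zero of \<open>H\<close> lies between
  neighbouring zeros of \<open>q\<close>, and a zero of \<open>q\<close> lies in every gap of the
  zeros of \<open>H\<close> together with two far points.\<close>

lemma card_roots_H_poly:
  fixes p :: "real poly"
  assumes "\<kappa> < 0" "degree p \<ge> 2"
    and simple: "\<And>x. poly p x = 0 \<Longrightarrow> poly (pderiv p) x \<noteq> 0"
    and simple': "\<And>x. poly (pderiv p) x = 0 \<Longrightarrow> poly (pderiv (pderiv p)) x \<noteq> 0"
    and laguerre: "\<And>x. poly (pderiv p) x * poly (pderiv (pderiv (pderiv p))) x \<le> (poly (pderiv (pderiv p)) x)\<^sup>2"
  shows "card {x. poly (H_poly \<kappa> p) x = 0} + 1 = card {x. poly (p * pderiv p) x = 0}"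
    and "\<And>x. poly (H_poly \<kappa> p) x = 0 \<Longrightarrow> order x (H_poly \<kappa> p) = 1"
proof -
  define q H where "q = p * pderiv p" and "H = H_poly \<kappa> p"
  define A B where "A = {x. poly q x = 0}" and "B = {x. poly H x = 0}"
  have q: "poly q x = poly p x * poly (pderiv p) x"
    "poly (pderiv q) x = (poly (pderiv p) x)\<^sup>2 + poly p x * poly (pderiv (pderiv p)) x" for x
    by (simp_all add: q_def pderiv_mult power2_eq_square)
  \<comment> \<open>At a zero of \<open>p\<close>, \<open>H\<close> is
    \<open>\<kappa> * p'^2\<close> and \<open>q'\<close> is \<open>p'^2\<close>; at a zero of
    \<open>p'\<close>, \<open>H\<close> is \<open>- p * p''\<close> and \<open>q'\<close> is
    \<open>p * p''\<close>. In particular \<open>q\<close> and \<open>H\<close> share no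
    zero.\<close>
  have at_q: "(- poly H x) * poly (pderiv q) x > 0" if "poly q x = 0" for x
  proof (cases "poly p x = 0")
    case True
    then have "(- poly H x) * poly (pderiv q) x = (- \<kappa>) * ((poly (pderiv p) x)\<^sup>2)\<^sup>2"
      by (simp add: q H_def poly_H_poly power2_eq_square)
    also have "\<dots> > 0" using assms(1) simple[OF True] by (intro mult_pos_pos) auto
    finally show ?thesis .
  next
    case False
    then have "poly (pderiv p) x = 0" using that by (simp add: q)
    moreover from this have "(- poly H x) * poly (pderiv q) x = (poly p x * poly (pderiv (pderiv p)) x)\<^sup>2"
      by (simp add: q H_def poly_H_poly power2_eq_square)
    ultimately show ?thesis using False simple' by simp
  qed
  have at_H: "poly q x * poly (pderiv H) x > 0" if "poly H x = 0" for x
  proof -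
    have "poly q x \<noteq> 0" using at_q[of x] that by auto
    then show ?thesis
      using pderiv_H_poly_sign[OF assms(1) _ _ _ laguerre] that by (auto simp: q_def H_def)
  qed
  obtain M where M: "\<And>x. x \<ge> M \<Longrightarrow> poly p x * poly (pderiv p) x > 0 \<and> poly p x * poly (pderiv (pderiv p)) x > 0"
    "\<And>x. x \<le> - M \<Longrightarrow> poly p x * poly (pderiv p) x < 0 \<and> poly p x * poly (pderiv (pderiv p)) x > 0"
    using poly_times_pderivs_signs_at_infinity[OF assms(2)] by blast
  \<comment> \<open>If \<open>M\<close> were nonpositive, both sign statements would apply at 0 and
    contradict each other.\<close>
  have Mpos: "M > 0" using M(1)[of "0"] M(2)[of "0"] M(1)[of M] M(2)[of M] by linarith
  have H_neg: "poly H x < 0" if "x \<ge> M \<or> x \<le> - M" for x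
  proof -
    have "\<kappa> * (poly (pderiv p) x)\<^sup>2 \<le> 0" using assms(1) by (simp add: mult_nonpos_nonneg)
    then show ?thesis using M that by (auto simp: H_def poly_H_poly intro: order.strict_trans1)
  qed
  have q_sgn: "poly q x > 0" if "x \<ge> M" for x using M(1) that by (simp add: q)
  have q_sgn': "poly q x < 0" if "x \<le> - M" for x using M(2) that by (simp add: q)
  have "q \<noteq> 0" "H \<noteq> 0" using H_neg[of M] q_sgn[of M] by auto
  then have fin: "finite A" "finite B" by (simp_all add: A_def B_def poly_roots_finite)
  have B_bound: "- M < x" "x < M" if "x \<in> B" for x
    using H_neg[of x] that by (force simp: B_def not_le[symmetric])+
  have "card A \<le> card B + 1"
  proof (rule card_le_Suc_card_between[OF fin])
    fix x y assume xy: "x \<in> A" "y \<in> A" "x < y" "A \<inter> {x<..<y} = {}"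
    have "\<exists>t>x. t < y \<and> poly (- H) t = 0"
      by (rule poly_root_between_simple_roots[of x y q])
        (use xy at_q in \<open>auto simp: A_def\<close>)
    then show "\<exists>b\<in>B. x < b \<and> b < y" by (auto simp: B_def)
  qed
  \<comment> \<open>Adjoining the far points makes the two outer gaps count: \<open>q * H\<close> is
    positive at \<open>- M\<close> and negative at \<open>M\<close>, so a zero of \<open>q\<close>
    lies outside the zeros of \<open>H\<close> on either side.\<close>
  moreover have "card (insert (- M) (insert M B)) \<le> card A + 1"
  proof (rule card_le_Suc_card_between)
    fix x y assume xy: "x \<in> insert (- M) (insert M B)" "y \<in> insert (- M) (insert M B)" "x < y"
      "insert (- M) (insert M B) \<inter> {x<..<y} = {}"
    have x: "x = - M \<or> x \<in> B" using xy B_bound Mpos by force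
    have y: "y = M \<or> y \<in> B" using xy B_bound Mpos by force
    have "\<exists>t>x. t < y \<and> poly q t = 0"
    proof (rule poly_root_between_simple_roots[of x y H])
      show "poly H x = 0 \<and> poly q x * poly (pderiv H) x > 0 \<or> poly q x * poly H x > 0"
        using x at_H H_neg[of "- M"] q_sgn'[of "- M"] by (auto simp: B_def mult_neg_neg)
      show "poly H y = 0 \<and> poly q y * poly (pderiv H) y > 0 \<or> poly q y * poly H y < 0"
        using y at_H H_neg[of M] q_sgn[of M] by (auto simp: B_def mult_pos_neg)
    qed (use xy in \<open>auto simp: B_def\<close>)
    then show "\<exists>b\<in>A. x < b \<and> b < y" by (auto simp: A_def)
  qed (use fin in auto)
  moreover have "card (insert (- M) (insert M B)) = card B + 2"
    using fin Mpos B_bound by (subst card_insert_disjoint; force)+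
  ultimately show "card {x. poly (H_poly \<kappa> p) x = 0} + 1 = card {x. poly (p * pderiv p) x = 0}"
    by (simp add: A_def B_def q_def H_def)
  show "order x (H_poly \<kappa> p) = 1" if "poly (H_poly \<kappa> p) x = 0" for x
    using order_eq_1_iff[OF \<open>H \<noteq> 0\<close>, of x] at_H[of x] that by (auto simp: H_def)
qed

section \<open>The zero count: simplicity of the zeros, then the cases of zero and negative
  \<open>\<kappa>\<close>\<close>

theorem theorem2p3:
  fixes \<kappa> :: real and n :: nat and p :: "real poly"
  assumes "\<kappa> \<le> 0"
    and "n \<ge> 2"
    and "degree p = n"
    and "\<And>x::real. poly p x = 0 \<Longrightarrow> order x p = 1"
    and "\<And>z::complex. poly (map_poly complex_of_real (pderiv p)) z = 0 \<Longrightarrow>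
           z \<in> \<real> \<and> order z (map_poly complex_of_real (pderiv p)) = 1"
  shows "int (Z_real (H_poly \<kappa> p)) = int n + int (Z_real p) - 2"
proof -
  have deg': "degree (pderiv p) = n - 1" "degree (pderiv (pderiv p)) = n - 2"
    using assms by (simp_all add: degree_pderiv)
  have nz: "p \<noteq> 0" "pderiv p \<noteq> 0" "pderiv (pderiv p) \<noteq> 0"
    using assms(2,3) deg' by (auto simp: pderiv_eq_0_iff)
  have rr: "\<forall>z. poly (map_poly complex_of_real (pderiv p)) z = 0 \<longrightarrow> z \<in> \<real>"
    using assms(5) by blast
  have simple: "poly (pderiv p) x \<noteq> 0" if "poly p x = 0" for x
    using order_eq_1_iff[OF nz(1) that] assms(4)[OF that] by simp
  have simple': "poly (pderiv (pderiv p)) x \<noteq> 0" if x: "poly (pderiv p) x = 0" for x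
  proof -
    \<comment> \<open>Simplicity is assumed for the complex zeros; differentiating lowers the order
      from 1 to 0, and the nonvanishing is then read off over the reals.\<close>
    define P where "P = map_poly complex_of_real (pderiv p)"
    have P0: "poly P (of_real x) = 0" using x by (simp add: P_def poly_map_complex_of_real)
    have "P \<noteq> 0" using nz(2) by (simp add: P_def map_poly_eq_0_iff)
    then have "order (of_real x) (pderiv P) = 0"
      using order_pderiv[OF _ P0] assms(5)[of "of_real x"] P0 by (simp add: P_def)
    moreover have "pderiv P \<noteq> 0"
      using nz(3) by (simp add: P_def pderiv_map_complex_of_real map_poly_eq_0_iff)
    ultimately have "poly (pderiv P) (of_real x) \<noteq> 0" by (simp add: order_eq_0_iff)
    then show ?thesis
      by (simp add: P_def pderiv_map_complex_of_real poly_map_complex_of_real)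
  qed
  have ord': "order x (pderiv p) = 1" if "poly (pderiv p) x = 0" for x
    using order_eq_1_iff[OF nz(2) that] simple'[OF that] by simp
  have "Z_real (pderiv p) = n - 1"
    using real_rooted_size_proots[OF rr nz(2)] nz(2) deg' by (simp add: Z_real_eq_size_proots)
  then have card': "card {x. poly (pderiv p) x = 0} = n - 1"
    using Z_real_simple[OF ord'] by simp
  show ?thesis
  proof (cases "\<kappa> = 0")
    case True
    \<comment> \<open>Rolle's theorem between the \<open>n - 1\<close> distinct zeros of
      \<open>p'\<close>; the degree of \<open>p''\<close> gives the matching upper bound.\<close>
    have "card {x. poly (pderiv p) x = 0} \<le> card {x. poly (pderiv (pderiv p)) x = 0} + 1"
    proof (rule card_le_Suc_card_between)
      fix x y :: real
      assume "x \<in> {x. poly (pderiv p) x = 0}" "y \<in> {x. poly (pderiv p) x = 0}" "x < y"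
      then show "\<exists>b\<in>{x. poly (pderiv (pderiv p)) x = 0}. x < b \<and> b < y"
        using poly_MVT[of x y "pderiv p"] by auto
    qed (use nz in \<open>simp_all add: poly_roots_finite\<close>)
    then have "n - 2 \<le> Z_real (pderiv (pderiv p))"
      using card_roots_le_Z_real[OF nz(3)] card' by linarith
    moreover have "Z_real (pderiv (pderiv p)) \<le> n - 2"
      using size_proots_le[of "pderiv (pderiv p)"] nz(3) deg' by (simp add: Z_real_eq_size_proots)
    \<comment> \<open>Here \<open>H\<close> is \<open>- p * p''\<close>. Its factors may share
      zeros, as for \<open>x^3 - x\<close>, so the zeros are added with multiplicity and not as
      sets.\<close>
    moreover have "Z_real (H_poly \<kappa> p) = Z_real p + Z_real (pderiv (pderiv p))"
      using True nz by (simp add: H_poly_def Z_real_uminus Z_real_mult)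
    ultimately show ?thesis using assms(2) by simp
  next
    case False
    then have "\<kappa> < 0" using assms(1) by simp
    note H = card_roots_H_poly[OF \<open>\<kappa> < 0\<close> _ simple simple' laguerre_inequality[OF rr nz(2)],
        unfolded assms(3), OF assms(2)]
    have "{x. poly (p * pderiv p) x = 0} = {x. poly p x = 0} \<union> {x. poly (pderiv p) x = 0}"
      by auto
    moreover have "{x. poly p x = 0} \<inter> {x. poly (pderiv p) x = 0} = {}"
      using simple by auto
    \<comment> \<open>The two zero sets are disjoint because the zeros of \<open>p\<close> are
      simple, which also makes their number equal to \<open>Z_real p\<close>.\<close>
    ultimately have "card {x. poly (p * pderiv p) x = 0} = Z_real p + (n - 1)"
      using nz card' Z_real_simple[OF assms(4)] by (simp add: card_Un_disjoint poly_roots_finite)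
    then show ?thesis
      using H Z_real_simple[of "H_poly \<kappa> p"] assms(2) by simp
  qed
qed

end
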